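(* Let $(\mathcal{R},\boxplus,\boxtimes,\zeta)$ be a proximal ring with unity. If $\lambda\in\mathcal{R}$ is an invertible element and $\mathcal{V}$ is a closed subset of $\mathcal{R}$, then the sets $\lambda\boxtimes\mathcal{V}=\{\lambda\boxtimes v : v\in\mathcal{V}\}$ and $\mathcal{V}\boxtimes\lambda=\{v\boxtimes\lambda : v\in\mathcal{V}\}$ are closed.
   Context: A ring is associative, not necessarily commutative; $\boxplus$ is its addition and $\boxtimes$ its multiplication. Invertible means having a two-sided multiplicative inverse. A proximity space $(\mathfrak{X},\zeta)$ is a nonempty set $\mathfrak{X}$ with a (Čech) proximity: a relation $\zeta$ on subsets of $\mathfrak{X}$ ("near") such that, for all $A,B,C\subseteq\mathfrak{X}$: $A\,\zeta\,B$ implies $B\,\zeta\,A$; $A\,\zeta\,B$ implies $A,B\neq\emptyset$; $A\cap B\neq\emptyset$ implies $A\,\zeta\,B$; and $A\,\zeta\,(B\cup C)$ if and only if $A\,\zeta\,B$ or $A\,\zeta\,C$. The closure of $A\subseteq\mathfrak{X}$ is $\mathrm{cl}_\zeta(A)=\{x\in\mathfrak{X} : \{x\}\,\zeta\,A\}$, and $A$ is closed if $\mathrm{cl}_\zeta(A)=A$. A map $f$ between proximity spaces is proximally continuous if $W$ near $K$ implies $f(W)$ near $f(K)$ for all subsets $W,K$ of its domain. The product of two proximity spaces carries the product proximity: $A$ is near $B$ if and only if for all finite decompositions $A=A_1\cup\dots\cup A_m$ and $B=B_1\cup\dots\cup B_n$ there are $i,j$ such that, for each coordinate projection $p$, $p(A_i)$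 is near $p(B_j)$. (On rectangles: $W_1\times W_2$ is near $K_1\times K_2$ if and only if $W_1$ is near $K_1$ and $W_2$ is near $K_2$.) A proximal ring $(\mathcal{R},\boxplus,\boxtimes,\zeta)$ is a ring with a proximity $\zeta$ such that addition $(w_0,w_1)\mapsto w_0\boxplus w_1$ and multiplication $(w_0,w_1)\mapsto w_0\boxtimes w_1$, as maps $\mathcal{R}\times\mathcal{R}\to\mathcal{R}$, and additive inversion $w\mapsto -w$, as a map $\mathcal{R}\to\mathcal{R}$, are proximally continuous. *)

theory Defs
  imports "HOL-Algebra.Ring"
begin

text \<open>Cech proximities on a carrier set \<open>X\<close>. The relation \<open>\<zeta>\<close> is only meaningful on subsets
  of \<open>X\<close>; nothing is assumed about its values on other sets.\<close>

locale proximity_space =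
  fixes X :: "'a set" and \<zeta> :: "'a set \<Rightarrow> 'a set \<Rightarrow> bool"
  assumes nonempty: "X \<noteq> {}"
    and near_sym: "\<lbrakk>A \<subseteq> X; B \<subseteq> X; \<zeta> A B\<rbrakk> \<Longrightarrow> \<zeta> B A"
    and near_nonempty: "\<lbrakk>A \<subseteq> X; B \<subseteq> X; \<zeta> A B\<rbrakk> \<Longrightarrow> A \<noteq> {} \<and> B \<noteq> {}"
    and near_Int: "\<lbrakk>A \<subseteq> X; B \<subseteq> X; A \<inter> B \<noteq> {}\<rbrakk> \<Longrightarrow> \<zeta> A B"
    and near_Un: "\<lbrakk>A \<subseteq> X; B \<subseteq> X; C \<subseteq> X\<rbrakk> \<Longrightarrow> \<zeta> A (B \<union> C) \<longleftrightarrow> \<zeta> A B \<or> \<zeta> A C"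

definition prox_closure :: "'a set \<Rightarrow> ('a set \<Rightarrow> 'a set \<Rightarrow> bool) \<Rightarrow> 'a set \<Rightarrow> 'a set" where
  "prox_closure X \<zeta> A = {x \<in> X. \<zeta> {x} A}"

definition prox_closed :: "'a set \<Rightarrow> ('a set \<Rightarrow> 'a set \<Rightarrow> bool) \<Rightarrow> 'a set \<Rightarrow> bool" where
  "prox_closed X \<zeta> A \<longleftrightarrow> A \<subseteq> X \<and> prox_closure X \<zeta> A = A"

definition prox_continuous ::
  "'a set \<Rightarrow> ('a set \<Rightarrow> 'a set \<Rightarrow> bool) \<Rightarrow> 'b set \<Rightarrow> ('b set \<Rightarrow> 'b set \<Rightarrow> bool) \<Rightarrow> ('a \<Rightarrow> 'b) \<Rightarrow> bool"
  where
  "prox_continuous X \<zeta> Y \<eta> f \<longleftrightarrow>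
     f \<in> X \<rightarrow> Y \<and> (\<forall>W K. W \<subseteq> X \<longrightarrow> K \<subseteq> X \<longrightarrow> \<zeta> W K \<longrightarrow> \<eta> (f ` W) (f ` K))"

text \<open>The product proximity; a finite decomposition of a set is a finite family of sets,
  not necessarily disjoint, whose union is that set.\<close>

definition prod_near ::
  "('a set \<Rightarrow> 'a set \<Rightarrow> bool) \<Rightarrow> ('b set \<Rightarrow> 'b set \<Rightarrow> bool) \<Rightarrow> ('a \<times> 'b) set \<Rightarrow> ('a \<times> 'b) set \<Rightarrow> bool"
  where
  "prod_near \<zeta> \<eta> A B \<longleftrightarrow>
     (\<forall>\<A> \<B>. finite \<A> \<longrightarrow> finite \<B> \<longrightarrow> \<Union>\<A> = A \<longrightarrow> \<Union>\<B> = B \<longrightarrow>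
        (\<exists>A'\<in>\<A>. \<exists>B'\<in>\<B>. \<zeta> (fst ` A') (fst ` B') \<and> \<eta> (snd ` A') (snd ` B')))"

text \<open>The locale \<^locale>\<open>ring\<close> includes a unity and does not exclude the zero ring.\<close>

locale proximal_ring = ring R + proximity_space "carrier R" \<zeta>
  for R (structure) and \<zeta> +
  assumes add_continuous:
      "prox_continuous (carrier R \<times> carrier R) (prod_near \<zeta> \<zeta>) (carrier R) \<zeta> (\<lambda>(x, y). x \<oplus> y)"
    and mult_continuous:
      "prox_continuous (carrier R \<times> carrier R) (prod_near \<zeta> \<zeta>) (carrier R) \<zeta> (\<lambda>(x, y). x \<otimes> y)"
    and minus_continuous: "prox_continuous (carrier R) \<zeta> (carrier R) \<zeta> (\<lambda>x. \<ominus> x)"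

end

theory Submission imports Defs begin

text \<open>
  Multiplying a closed set by a unit \<open>l\<close> amounts to taking its preimage under multiplication by
  \<open>inv l\<close>, and preimages of closed sets under proximally continuous maps are closed
  (\<open>prox_closed_vimage\<close>). It therefore suffices that every translation \<open>x \<mapsto> a \<otimes> x\<close> and
  \<open>x \<mapsto> x \<otimes> a\<close> is proximally continuous.

  Multiplication is continuous only jointly, for the product proximity, so one has to know that
  near sets \<open>A\<close>, \<open>B\<close> give near slices \<open>{a} \<times> A\<close>, \<open>{a} \<times> B\<close> (\<open>prod_near_slice_left\<close>). A finite
  decomposition of a slice projects to a finite decomposition of its long side, and nearness of
  two sets always passes to some pair of pieces of finite decompositions (\<open>near_Union_Union\<close>).
  Those two pieces are nonempty, so their projections to the short side both equal \<open>{a}\<close>.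
\<close>

context proximity_space
begin

lemma near_mono:
  assumes "A \<subseteq> X" "C \<subseteq> X" "B \<subseteq> C" "\<zeta> A B"
  shows "\<zeta> A C"
proof -
  have "\<zeta> A (B \<union> C)"
    using assms near_Un[of A B C] by blast
  then show ?thesis
    using assms(3) by (simp add: Un_absorb1)
qed

lemma near_Union:
  assumes "finite \<B>" "A \<subseteq> X" "\<Union>\<B> \<subseteq> X" "\<zeta> A (\<Union>\<B>)"
  shows "\<exists>B\<in>\<B>. \<zeta> A B"
  using assms
proof (induction \<B> rule: finite_induct)
  case empty
  then show ?case
    using near_nonempty[of A "{}"] by simp
next
  case (insert B \<B>)
  then have "\<zeta> A B \<or> \<zeta> A (\<Union>\<B>)"
    using near_Un[of A B "\<Union>\<B>"] by simp
  then show ?case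
    using insert by auto
qed

lemma near_Union_Union:
  assumes "finite \<A>" "finite \<B>" "\<Union>\<A> \<subseteq> X" "\<Union>\<B> \<subseteq> X" "\<zeta> (\<Union>\<A>) (\<Union>\<B>)"
  shows "\<exists>A\<in>\<A>. \<exists>B\<in>\<B>. \<zeta> A B"
proof -
  obtain B where B: "B \<in> \<B>" "\<zeta> (\<Union>\<A>) B"
    using near_Union[of \<B> "\<Union>\<A>"] assms by blast
  have BX: "B \<subseteq> X"
    using B(1) assms(4) by blast
  obtain A where A: "A \<in> \<A>" "\<zeta> B A"
    using near_Union[of \<A> B] near_sym[OF assms(3) BX B(2)] assms(1,3) BX by blast
  have "A \<subseteq> X"
    using A(1) assms(3) by blast
  then show ?thesis
    using near_sym[OF BX _ A(2)] A(1) B(1) by blast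
qed

end

lemma prox_continuousD:
  assumes "prox_continuous X \<zeta> Y \<eta> f"
  shows "x \<in> X \<Longrightarrow> f x \<in> Y"
    and "W \<subseteq> X \<Longrightarrow> K \<subseteq> X \<Longrightarrow> \<zeta> W K \<Longrightarrow> \<eta> (f ` W) (f ` K)"
  using assms unfolding prox_continuous_def by blast+

text \<open>A point near the preimage of \<open>V\<close> is sent to a point near a subset of \<open>V\<close>, hence near \<open>V\<close>,
  hence into \<open>V\<close>.\<close>

lemma prox_closed_vimage:
  assumes "proximity_space X \<zeta>" "proximity_space Y \<eta>"
    and "prox_continuous X \<zeta> Y \<eta> f" "prox_closed Y \<eta> V"
  shows "prox_closed X \<zeta> {x \<in> X. f x \<in> V}"
proof -
  interpret X: proximity_space X \<zeta> by fact
  interpret Y: proximity_space Y \<eta> by fact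
  let ?P = "{x \<in> X. f x \<in> V}"
  have V: "V \<subseteq> Y" "{y \<in> Y. \<eta> {y} V} = V"
    using assms(4) by (auto simp: prox_closed_def prox_closure_def)
  have "x \<in> ?P" if x: "x \<in> X" "\<zeta> {x} ?P" for x
  proof -
    have fx: "f x \<in> Y"
      using prox_continuousD(1)[OF assms(3) x(1)] .
    have "\<eta> (f ` {x}) (f ` ?P)"
      by (rule prox_continuousD(2)[OF assms(3)]) (use x in blast)+
    then have "\<eta> {f x} (f ` ?P)"
      by simp
    then have "\<eta> {f x} V"
      by (rule Y.near_mono[rotated 3]) (use fx V(1) in blast)+
    then show ?thesis
      using fx V(2) x(1) by blast
  qed
  moreover have "\<zeta> {x} ?P" if "x \<in> ?P" for x
    using that by (intro X.near_Int) auto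
  ultimately show ?thesis
    unfolding prox_closed_def prox_closure_def by blast
qed

text \<open>Along a slice the first projections of two pieces both equal \<open>{a}\<close> unless a piece is empty,
  so only the second projections have to be made near. The chosen pieces cannot be empty because
  the empty set is near nothing.\<close>

lemma prod_near_slice_left:
  assumes "proximity_space X \<zeta>" "proximity_space Y \<eta>"
    and a: "a \<in> X" and A: "A \<subseteq> Y" and B: "B \<subseteq> Y" and near: "\<eta> A B"
  shows "prod_near \<zeta> \<eta> ({a} \<times> A) ({a} \<times> B)"
  unfolding prod_near_def
proof (intro allI impI)
  interpret X: proximity_space X \<zeta> by fact
  interpret Y: proximity_space Y \<eta> by fact
  fix \<A> \<B> :: "('a \<times> 'b) set set"
  assume fin: "finite \<A>" "finite \<B>" and un: "\<Union>\<A> = {a} \<times> A" "\<Union>\<B> = {a} \<times> B"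
  have proj: "\<Union>((`) snd ` \<A>) = A" "\<Union>((`) snd ` \<B>) = B"
    unfolding image_Union[symmetric] un by simp_all
  have "\<exists>A'\<in>(`) snd ` \<A>. \<exists>B'\<in>(`) snd ` \<B>. \<eta> A' B'"
    by (rule Y.near_Union_Union) (use fin proj A B near in simp_all)
  then obtain A' B' where pieces: "A' \<in> \<A>" "B' \<in> \<B>" "\<eta> (snd ` A') (snd ` B')"
    by blast
  have sub: "A' \<subseteq> {a} \<times> A" "B' \<subseteq> {a} \<times> B"
    using pieces(1,2) un by auto
  have "snd ` A' \<subseteq> Y" "snd ` B' \<subseteq> Y"
    using sub A B by auto
  from Y.near_nonempty[OF this pieces(3)] have "A' \<noteq> {}" "B' \<noteq> {}"
    by simp_all
  moreover have "fst ` A' \<subseteq> {a}" "fst ` B' \<subseteq> {a}"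
    using sub by auto
  ultimately have "fst ` A' = {a}" "fst ` B' = {a}"
    by (simp_all add: subset_singleton_iff)
  then have "\<zeta> (fst ` A') (fst ` B')"
    using X.near_Int[of "{a}" "{a}"] a by simp
  then show "\<exists>A'\<in>\<A>. \<exists>B'\<in>\<B>. \<zeta> (fst ` A') (fst ` B') \<and> \<eta> (snd ` A') (snd ` B')"
    using pieces by blast
qed

text \<open>A decomposition of a swapped set swaps back to a decomposition of the set itself. This
  carries nearness of left slices over to right slices.\<close>

lemma prod_near_swap:
  assumes "prod_near \<zeta> \<eta> A B"
  shows "prod_near \<eta> \<zeta> (prod.swap ` A) (prod.swap ` B)"
  unfolding prod_near_def
proof (intro allI impI)
  fix \<A> \<B>
  assume fin: "finite \<A>" "finite \<B>"
    and un: "\<Union>\<A> = prod.swap ` A" "\<Union>\<B> = prod.swap ` B"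
  have "\<Union>((`) prod.swap ` \<A>) = A" "\<Union>((`) prod.swap ` \<B>) = B"
    unfolding image_Union[symmetric] un by (simp_all add: image_image)
  then have "\<exists>A'\<in>(`) prod.swap ` \<A>. \<exists>B'\<in>(`) prod.swap ` \<B>.
      \<zeta> (fst ` A') (fst ` B') \<and> \<eta> (snd ` A') (snd ` B')"
    using assms[unfolded prod_near_def, rule_format] fin by blast
  then show "\<exists>A'\<in>\<A>. \<exists>B'\<in>\<B>. \<eta> (fst ` A') (fst ` B') \<and> \<zeta> (snd ` A') (snd ` B')"
    by (auto simp: image_image)
qed

lemma prod_near_slice_right:
  assumes "proximity_space X \<zeta>" "proximity_space Y \<eta>"
    and "a \<in> Y" "A \<subseteq> X" "B \<subseteq> X" "\<zeta> A B"
  shows "prod_near \<zeta> \<eta> (A \<times> {a}) (B \<times> {a})"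
  using prod_near_swap[OF prod_near_slice_left[OF assms(2,1,3-6)]]
  by (simp add: product_swap)

context proximal_ring
begin

lemma proximity: "proximity_space (carrier R) \<zeta>"
  by unfold_locales

lemma left_translation_continuous:
  assumes a: "a \<in> carrier R"
  shows "prox_continuous (carrier R) \<zeta> (carrier R) \<zeta> (\<lambda>x. a \<otimes> x)"
proof -
  have "\<zeta> ((\<lambda>x. a \<otimes> x) ` W) ((\<lambda>x. a \<otimes> x) ` K)"
    if "W \<subseteq> carrier R" "K \<subseteq> carrier R" "\<zeta> W K" for W K
  proof -
    have "\<zeta> ((\<lambda>(x, y). x \<otimes> y) ` ({a} \<times> W)) ((\<lambda>(x, y). x \<otimes> y) ` ({a} \<times> K))"
      by (rule prox_continuousD(2)[OF mult_continuous _ _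
            prod_near_slice_left[OF proximity proximity a that]]) (use a that(1,2) in blast)+
    moreover have "(\<lambda>(x, y). x \<otimes> y) ` ({a} \<times> S) = (\<lambda>x. a \<otimes> x) ` S" for S
      by force
    ultimately show ?thesis by simp
  qed
  then show ?thesis
    using a by (auto simp: prox_continuous_def)
qed

lemma right_translation_continuous:
  assumes a: "a \<in> carrier R"
  shows "prox_continuous (carrier R) \<zeta> (carrier R) \<zeta> (\<lambda>x. x \<otimes> a)"
proof -
  have "\<zeta> ((\<lambda>x. x \<otimes> a) ` W) ((\<lambda>x. x \<otimes> a) ` K)"
    if "W \<subseteq> carrier R" "K \<subseteq> carrier R" "\<zeta> W K" for W K
  proof -
    have "\<zeta> ((\<lambda>(x, y). x \<otimes> y) ` (W \<times> {a})) ((\<lambda>(x, y). x \<otimes> y) ` (K \<times> {a}))"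
      by (rule prox_continuousD(2)[OF mult_continuous _ _
            prod_near_slice_right[OF proximity proximity a that]]) (use a that(1,2) in blast)+
    moreover have "(\<lambda>(x, y). x \<otimes> y) ` (S \<times> {a}) = (\<lambda>x. x \<otimes> a) ` S" for S
      by force
    ultimately show ?thesis by simp
  qed
  then show ?thesis
    using a by (auto simp: prox_continuous_def)
qed

end

lemma (in monoid) unit_left_mult_eq_vimage:
  assumes l: "l \<in> Units G" and V: "V \<subseteq> carrier G"
  shows "{l \<otimes> v | v. v \<in> V} = {x \<in> carrier G. inv l \<otimes> x \<in> V}"
proof -
  have cancel: "inv l \<otimes> (l \<otimes> v) = v" "l \<otimes> (inv l \<otimes> v) = v" if "v \<in> carrier G" for v
    using l that by (simp_all add: Units_closed flip: m_assoc)
  show ?thesis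
  proof (intro equalityI subsetI)
    fix x
    assume "x \<in> {l \<otimes> v | v. v \<in> V}"
    then obtain v where "v \<in> V" "x = l \<otimes> v"
      by blast
    then show "x \<in> {x \<in> carrier G. inv l \<otimes> x \<in> V}"
      using l V cancel(1)[of v] by (simp add: Units_closed subsetD)
  next
    fix x
    assume x: "x \<in> {x \<in> carrier G. inv l \<otimes> x \<in> V}"
    then have "x = l \<otimes> (inv l \<otimes> x)"
      using cancel(2)[of x] by simp
    then show "x \<in> {l \<otimes> v | v. v \<in> V}"
      using x by blast
  qed
qed

lemma (in monoid) unit_right_mult_eq_vimage:
  assumes l: "l \<in> Units G" and V: "V \<subseteq> carrier G"
  shows "{v \<otimes> l | v. v \<in> V} = {x \<in> carrier G. x \<otimes> inv l \<in> V}"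
proof -
  have cancel: "(v \<otimes> l) \<otimes> inv l = v" "(v \<otimes> inv l) \<otimes> l = v" if "v \<in> carrier G" for v
    using l that by (simp_all add: Units_closed m_assoc)
  show ?thesis
  proof (intro equalityI subsetI)
    fix x
    assume "x \<in> {v \<otimes> l | v. v \<in> V}"
    then obtain v where "v \<in> V" "x = v \<otimes> l"
      by blast
    then show "x \<in> {x \<in> carrier G. x \<otimes> inv l \<in> V}"
      using l V cancel(1)[of v] by (simp add: Units_closed subsetD)
  next
    fix x
    assume x: "x \<in> {x \<in> carrier G. x \<otimes> inv l \<in> V}"
    then have "x = (x \<otimes> inv l) \<otimes> l"
      using cancel(2)[of x] by simp
    then show "x \<in> {v \<otimes> l | v. v \<in> V}"
      using x by blast
  qed
qed

theorem proposition4: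
  fixes R :: "('a, 'm) ring_scheme" (structure)
    and \<zeta> :: "'a set \<Rightarrow> 'a set \<Rightarrow> bool"
    and l :: 'a and V :: "'a set"
  assumes "proximal_ring R \<zeta>"
    and "l \<in> Units R"
    and "prox_closed (carrier R) \<zeta> V"
  shows "prox_closed (carrier R) \<zeta> {l \<otimes> v | v. v \<in> V}
       \<and> prox_closed (carrier R) \<zeta> {v \<otimes> l | v. v \<in> V}"
proof -
  interpret proximal_ring R \<zeta> by fact
  have V: "V \<subseteq> carrier R"
    using assms(3) by (simp add: prox_closed_def)
  have inv_l: "inv l \<in> carrier R"
    using assms(2) by simp
  show ?thesis
    unfolding unit_left_mult_eq_vimage[OF assms(2) V] unit_right_mult_eq_vimage[OF assms(2) V]
    using left_translation_continuous[OF inv_l] right_translation_continuous[OF inv_l]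
    by (intro conjI prox_closed_vimage[OF proximity proximity _ assms(3)])
qed

end
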